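(* The subalgebra $\mathrm Y^{\rm tw}_q(\mathfrak o_N)$ of $\mathrm U_q(\widehat{\mathfrak{gl}}_N)$ is a left coideal, that is, $\Delta(\mathrm Y^{\rm tw}_q(\mathfrak o_N))\subset \mathrm U_q(\widehat{\mathfrak{gl}}_N)\otimes\mathrm Y^{\rm tw}_q(\mathfrak o_N)$, and $$\Delta(s_{ij}(u))=\sum_{k,l=1}^N t_{ik}(u)\,\bar t_{jl}(u^{-1})\otimes s_{kl}(u)\qquad(1\le i,j\le N).$$
   Context: Fix $q\in\mathbb C$, nonzero and not a root of unity. $E_{ij}$ are matrix units; a matrix $M=(m_{ij})$ over an algebra is identified with $\sum m_{ij}\otimes E_{ij}$, and $M_a$ means that $M$ acts in the $a$-th copy of $\mathrm{End}\,\mathbb C^N$. Put $$R(u,v)=(u-v)\sum_{i\ne j}E_{ii}\otimes E_{jj}+(q^{-1}u-qv)\sum_iE_{ii}\otimes E_{ii}+(q^{-1}-q)u\sum_{i>j}E_{ij}\otimes E_{ji}+(q^{-1}-q)v\sum_{i<j}E_{ij}\otimes E_{ji}.$$ The quantum affine algebra $\mathrm U_q(\widehat{\mathfrak{gl}}_N)$ is generated by $t_{ij}^{(r)},\bar t_{ij}^{\,(r)}$ ($1\le i,j\le N$, $r\ge0$). With $t_{ij}(u)=\sum_{r\ge0}t_{ij}^{(r)}u^{-r}$, $\bar t_{ij}(u)=\sum_{r\ge0}\bar t_{ij}^{\,(r)}u^{r}$, $T(u)=(t_{ij}(u))$, $\overline T(u)=(\bar t_{ij}(u))$, the defining relations are: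 $t_{ij}^{(0)}=\bar t_{ji}^{\,(0)}=0$ for $i<j$; $t_{ii}^{(0)}\bar t_{ii}^{\,(0)}=\bar t_{ii}^{\,(0)}t_{ii}^{(0)}=1$; $R(u,v)T_1(u)T_2(v)=T_2(v)T_1(u)R(u,v)$; $R(u,v)\overline T_1(u)\overline T_2(v)=\overline T_2(v)\overline T_1(u)R(u,v)$; $R(u,v)\overline T_1(u)T_2(v)=T_2(v)\overline T_1(u)R(u,v)$. It is a Hopf algebra with coproduct $\Delta(t_{ij}(u))=\sum_k t_{ik}(u)\otimes t_{kj}(u)$, $\Delta(\bar t_{ij}(u))=\sum_k\bar t_{ik}(u)\otimes\bar t_{kj}(u)$. $\mathrm Y^{\rm tw}_q(\mathfrak o_N)$ is the subalgebra generated by the coefficients of the series $s_{ij}(u)=\sum_{a=1}^N t_{ia}(u)\,\bar t_{ja}(u^{-1})$ in $u^{-1}$, $1\le i,j\le N$. *)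

theory Defs
  imports Complex_Main "HOL-Algebra.QuotRing" "HOL-Algebra.Module" "HOL-Library.Poly_Mapping"
begin

section \<open>Associative unital algebras over the complex numbers\<close>

text \<open>
  A (not necessarily commutative) complex algebra is a record of type
  \<^typ>\<open>(complex, 'a) module\<close>, that is, a ring together with a scalar multiplication.
\<close>

definition monoid_algebra ::
    "('a, 'm) monoid_scheme \<Rightarrow> (complex, 'a \<Rightarrow>\<^sub>0 complex) module" where
  "monoid_algebra M =
    \<lparr> carrier = {x. Poly_Mapping.keys x \<subseteq> carrier M},
      mult = (\<lambda>x y. \<Sum>a\<in>Poly_Mapping.keys x. \<Sum>b\<in>Poly_Mapping.keys y.
                Poly_Mapping.single (a \<otimes>\<^bsub>M\<^esub> b) (Poly_Mapping.lookup x a * Poly_Mapping.lookup y b)),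
      one = Poly_Mapping.single \<one>\<^bsub>M\<^esub> 1,
      zero = 0,
      add = (+),
      smult = (\<lambda>c. Poly_Mapping.map ((*) c)) \<rparr>"

definition free_algebra :: "(complex, 'g list \<Rightarrow>\<^sub>0 complex) module" where
  "free_algebra = monoid_algebra \<lparr> carrier = UNIV, mult = (@), one = [] \<rparr>"

definition quot_algebra :: "(complex, 'a) module \<Rightarrow> 'a set \<Rightarrow> (complex, 'a set) module" where
  "quot_algebra A I =
    \<lparr> carrier = carrier (A Quot I),
      mult = mult (A Quot I),
      one = one (A Quot I),
      zero = zero (A Quot I),
      add = add (A Quot I),
      smult = (\<lambda>c X. \<Union>x\<in>X. I +>\<^bsub>A\<^esub> (c \<odot>\<^bsub>A\<^esub> x)) \<rparr>"

definition algebra_hom :: "(complex, 'a) module \<Rightarrow> (complex, 'b) module \<Rightarrow> ('a \<Rightarrow> 'b) set" where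
  "algebra_hom A B =
    {h \<in> ring_hom A B. \<forall>c. \<forall>x\<in>carrier A. h (c \<odot>\<^bsub>A\<^esub> x) = c \<odot>\<^bsub>B\<^esub> h x}"

inductive_set gen_subalgebra :: "(complex, 'a) module \<Rightarrow> 'a set \<Rightarrow> 'a set"
  for A :: "(complex, 'a) module" and S :: "'a set" where
  one: "\<one>\<^bsub>A\<^esub> \<in> gen_subalgebra A S"
| incl: "x \<in> S \<Longrightarrow> x \<in> gen_subalgebra A S"
| add: "x \<in> gen_subalgebra A S \<Longrightarrow> y \<in> gen_subalgebra A S \<Longrightarrow> x \<oplus>\<^bsub>A\<^esub> y \<in> gen_subalgebra A S"
| mult: "x \<in> gen_subalgebra A S \<Longrightarrow> y \<in> gen_subalgebra A S \<Longrightarrow> x \<otimes>\<^bsub>A\<^esub> y \<in> gen_subalgebra A S"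
| smult: "x \<in> gen_subalgebra A S \<Longrightarrow> c \<odot>\<^bsub>A\<^esub> x \<in> gen_subalgebra A S"

inductive_set lin_span :: "(complex, 'a) module \<Rightarrow> 'a set \<Rightarrow> 'a set"
  for A :: "(complex, 'a) module" and S :: "'a set" where
  zero: "\<zero>\<^bsub>A\<^esub> \<in> lin_span A S"
| incl: "x \<in> S \<Longrightarrow> x \<in> lin_span A S"
| add: "x \<in> lin_span A S \<Longrightarrow> y \<in> lin_span A S \<Longrightarrow> x \<oplus>\<^bsub>A\<^esub> y \<in> lin_span A S"
| smult: "x \<in> lin_span A S \<Longrightarrow> c \<odot>\<^bsub>A\<^esub> x \<in> lin_span A S"


section \<open>Tensor product of algebras\<close>

text \<open>
  The vector space with basis the set of pairs \<open>(a, b)\<close>, multiplied componentwise, is the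
  monoid algebra of the product monoid. The bilinearity relations span a two-sided ideal of it,
  so the quotient by the ideal they generate is the usual tensor product, with
  \<open>(a \<otimes> b) (a' \<otimes> b') = a a' \<otimes> b b'\<close>.
\<close>

definition pair_algebra ::
    "(complex, 'a) module \<Rightarrow> (complex, 'b) module \<Rightarrow> (complex, 'a \<times> 'b \<Rightarrow>\<^sub>0 complex) module" where
  "pair_algebra A B = monoid_algebra (A \<times>\<times> B)"

definition bilinear_rels ::
    "(complex, 'a) module \<Rightarrow> (complex, 'b) module \<Rightarrow> ('a \<times> 'b \<Rightarrow>\<^sub>0 complex) set" where
  "bilinear_rels A B =
     (let d = (\<lambda>a b. Poly_Mapping.single (a, b) (1::complex)); P = pair_algebra A B in
        {d (a \<oplus>\<^bsub>A\<^esub> a') b - d a b - d a' b |a a' b.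
           a \<in> carrier A \<and> a' \<in> carrier A \<and> b \<in> carrier B}
      \<union> {d a (b \<oplus>\<^bsub>B\<^esub> b') - d a b - d a b' |a b b'.
           a \<in> carrier A \<and> b \<in> carrier B \<and> b' \<in> carrier B}
      \<union> {d (c \<odot>\<^bsub>A\<^esub> a) b - c \<odot>\<^bsub>P\<^esub> d a b |c a b. a \<in> carrier A \<and> b \<in> carrier B}
      \<union> {d a (c \<odot>\<^bsub>B\<^esub> b) - c \<odot>\<^bsub>P\<^esub> d a b |c a b. a \<in> carrier A \<and> b \<in> carrier B})"

definition bilinear_ideal ::
    "(complex, 'a) module \<Rightarrow> (complex, 'b) module \<Rightarrow> ('a \<times> 'b \<Rightarrow>\<^sub>0 complex) set" where
  "bilinear_ideal A B = Idl\<^bsub>pair_algebra A B\<^esub> (bilinear_rels A B)"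

definition tensor_algebra ::
    "(complex, 'a) module \<Rightarrow> (complex, 'b) module \<Rightarrow> (complex, ('a \<times> 'b \<Rightarrow>\<^sub>0 complex) set) module" where
  "tensor_algebra A B = quot_algebra (pair_algebra A B) (bilinear_ideal A B)"

definition tensor ::
    "(complex, 'a) module \<Rightarrow> (complex, 'b) module \<Rightarrow> 'a \<Rightarrow> 'b \<Rightarrow> ('a \<times> 'b \<Rightarrow>\<^sub>0 complex) set" where
  "tensor A B a b = bilinear_ideal A B +>\<^bsub>pair_algebra A B\<^esub> Poly_Mapping.single (a, b) 1"

text \<open>For subspaces \<open>V\<close> of \<open>A\<close> and \<open>W\<close> of \<open>B\<close>, the subspace \<open>V \<otimes> W\<close> of \<open>A \<otimes> B\<close>.\<close>

definition tensor_subspace ::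
    "(complex, 'a) module \<Rightarrow> (complex, 'b) module \<Rightarrow> 'a set \<Rightarrow> 'b set \<Rightarrow> ('a \<times> 'b \<Rightarrow>\<^sub>0 complex) set set" where
  "tensor_subspace A B V W = lin_span (tensor_algebra A B) {tensor A B v w |v w. v \<in> V \<and> w \<in> W}"


section \<open>Formal series\<close>

text \<open>
  A formal power series in one variable with coefficients in an algebra is its coefficient
  sequence, of type \<^typ>\<open>nat \<Rightarrow> 'a\<close>.
\<close>

definition ser_mult :: "(complex, 'a) module \<Rightarrow> (nat \<Rightarrow> 'a) \<Rightarrow> (nat \<Rightarrow> 'a) \<Rightarrow> nat \<Rightarrow> 'a" where
  "ser_mult A f g r = (\<Oplus>\<^bsub>A\<^esub>p\<in>{..r}. f p \<otimes>\<^bsub>A\<^esub> g (r - p))"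

definition ser_tensor ::
    "(complex, 'a) module \<Rightarrow> (complex, 'b) module \<Rightarrow> (nat \<Rightarrow> 'a) \<Rightarrow> (nat \<Rightarrow> 'b)
      \<Rightarrow> nat \<Rightarrow> ('a \<times> 'b \<Rightarrow>\<^sub>0 complex) set" where
  "ser_tensor A B f g r = (\<Oplus>\<^bsub>tensor_algebra A B\<^esub>p\<in>{..r}. tensor A B (f p) (g (r - p)))"


section \<open>The quantum affine algebra\<close>

text \<open>
  The index set \<open>{1, \<dots>, N}\<close> is a type \<open>'n\<close> of class \<^class>\<open>finite\<close> and \<^class>\<open>linorder\<close>,
  so \<open>N = CARD('n)\<close>.
\<close>

datatype 'n qgen = GenT 'n 'n nat | GenTbar 'n 'n nat

text \<open>The coefficient of \<open>E\<^sub>i\<^sub>j \<otimes> E\<^sub>k\<^sub>l\<close> in \<open>R(u, v)\<close>:\<close>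

definition Rmat ::
    "complex \<Rightarrow> complex \<Rightarrow> complex \<Rightarrow> 'n::linorder \<Rightarrow> 'n \<Rightarrow> 'n \<Rightarrow> 'n \<Rightarrow> complex" where
  "Rmat q u v i j k l =
     (u - v) * of_bool (i = j \<and> k = l \<and> i \<noteq> k)
   + (inverse q * u - q * v) * of_bool (i = j \<and> k = l \<and> i = k)
   + (inverse q - q) * u * of_bool (i > j \<and> k = j \<and> l = i)
   + (inverse q - q) * v * of_bool (i < j \<and> k = j \<and> l = i)"

text \<open>
  Bilateral coefficient sequences: the value at \<open>m\<close> is the coefficient of \<open>u\<^sup>m\<close> in
  \<open>t\<^sub>i\<^sub>j(u)\<close>, a series in \<open>u\<^sup>-\<^sup>1\<close>, respectively in the series \<open>tbar\<^sub>i\<^sub>j(u)\<close> in \<open>u\<close>.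
\<close>

definition free_t :: "'n \<Rightarrow> 'n \<Rightarrow> int \<Rightarrow> ('n qgen list \<Rightarrow>\<^sub>0 complex)" where
  "free_t i j m = (if m \<le> 0 then Poly_Mapping.single [GenT i j (nat (- m))] 1 else 0)"

definition free_tbar :: "'n \<Rightarrow> 'n \<Rightarrow> int \<Rightarrow> ('n qgen list \<Rightarrow>\<^sub>0 complex)" where
  "free_tbar i j m = (if m \<ge> 0 then Poly_Mapping.single [GenTbar i j (nat m)] 1 else 0)"

text \<open>
  The coefficients of \<open>E\<^sub>i\<^sub>j \<otimes> E\<^sub>k\<^sub>l u\<^sup>m v\<^sup>n\<close> in \<open>R(u,v) X\<^sub>1(u) Y\<^sub>2(v)\<close> and in
  \<open>Y\<^sub>2(v) X\<^sub>1(u) R(u,v)\<close>. As \<open>R(u,v)\<close> is homogeneous linear in \<open>u, v\<close>, its coefficients at \<open>u\<close>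
  and at \<open>v\<close> are \<open>R(1,0)\<close> and \<open>R(0,1)\<close>.
\<close>

definition RXY ::
    "(complex, 'a) module \<Rightarrow> complex \<Rightarrow> ('n \<Rightarrow> 'n \<Rightarrow> int \<Rightarrow> 'a) \<Rightarrow> ('n \<Rightarrow> 'n \<Rightarrow> int \<Rightarrow> 'a)
      \<Rightarrow> 'n::{finite,linorder} \<Rightarrow> 'n \<Rightarrow> 'n \<Rightarrow> 'n \<Rightarrow> int \<Rightarrow> int \<Rightarrow> 'a" where
  "RXY A q X Y i j k l m n =
     (\<Oplus>\<^bsub>A\<^esub>a\<in>UNIV. \<Oplus>\<^bsub>A\<^esub>b\<in>UNIV.
         Rmat q 1 0 i a k b \<odot>\<^bsub>A\<^esub> (X a j (m - 1) \<otimes>\<^bsub>A\<^esub> Y b l n)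
       \<oplus>\<^bsub>A\<^esub> Rmat q 0 1 i a k b \<odot>\<^bsub>A\<^esub> (X a j m \<otimes>\<^bsub>A\<^esub> Y b l (n - 1)))"

definition YXR ::
    "(complex, 'a) module \<Rightarrow> complex \<Rightarrow> ('n \<Rightarrow> 'n \<Rightarrow> int \<Rightarrow> 'a) \<Rightarrow> ('n \<Rightarrow> 'n \<Rightarrow> int \<Rightarrow> 'a)
      \<Rightarrow> 'n::{finite,linorder} \<Rightarrow> 'n \<Rightarrow> 'n \<Rightarrow> 'n \<Rightarrow> int \<Rightarrow> int \<Rightarrow> 'a" where
  "YXR A q X Y i j k l m n =
     (\<Oplus>\<^bsub>A\<^esub>a\<in>UNIV. \<Oplus>\<^bsub>A\<^esub>b\<in>UNIV.
         Rmat q 1 0 a j b l \<odot>\<^bsub>A\<^esub> (Y k b n \<otimes>\<^bsub>A\<^esub> X i a (m - 1))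
       \<oplus>\<^bsub>A\<^esub> Rmat q 0 1 a j b l \<odot>\<^bsub>A\<^esub> (Y k b (n - 1) \<otimes>\<^bsub>A\<^esub> X i a m))"

definition Uq_rels :: "complex \<Rightarrow> ('n::{finite,linorder} qgen list \<Rightarrow>\<^sub>0 complex) set" where
  "Uq_rels q =
     (let F = free_algebra in
        {free_t i j 0 |i j. i < j}
      \<union> {free_tbar j i 0 |i j. i < j}
      \<union> {free_t i i 0 \<otimes>\<^bsub>F\<^esub> free_tbar i i 0 - \<one>\<^bsub>F\<^esub> |i. True}
      \<union> {free_tbar i i 0 \<otimes>\<^bsub>F\<^esub> free_t i i 0 - \<one>\<^bsub>F\<^esub> |i. True}
      \<union> {RXY F q free_t free_t i j k l m n - YXR F q free_t free_t i j k l m n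
           |i j k l m n. True}
      \<union> {RXY F q free_tbar free_tbar i j k l m n - YXR F q free_tbar free_tbar i j k l m n
           |i j k l m n. True}
      \<union> {RXY F q free_tbar free_t i j k l m n - YXR F q free_tbar free_t i j k l m n
           |i j k l m n. True})"

definition Uq_ideal :: "complex \<Rightarrow> ('n::{finite,linorder} qgen list \<Rightarrow>\<^sub>0 complex) set" where
  "Uq_ideal q = Idl\<^bsub>free_algebra\<^esub> (Uq_rels q)"

definition Uq :: "complex \<Rightarrow> (complex, ('n::{finite,linorder} qgen list \<Rightarrow>\<^sub>0 complex) set) module" where
  "Uq q = quot_algebra free_algebra (Uq_ideal q)"

text \<open>\<open>t_ser q i j\<close> is the series \<open>t\<^sub>i\<^sub>j(u)\<close> in \<open>u\<^sup>-\<^sup>1\<close>; \<open>tbar_ser q i j\<close> is the series \<open>tbar\<^sub>i\<^sub>j(u)\<close> in \<open>u\<close>.\<close>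

definition t_ser :: "complex \<Rightarrow> 'n::{finite,linorder} \<Rightarrow> 'n \<Rightarrow> nat \<Rightarrow> ('n qgen list \<Rightarrow>\<^sub>0 complex) set" where
  "t_ser q i j r = Uq_ideal q +>\<^bsub>free_algebra\<^esub> Poly_Mapping.single [GenT i j r] 1"

definition tbar_ser :: "complex \<Rightarrow> 'n::{finite,linorder} \<Rightarrow> 'n \<Rightarrow> nat \<Rightarrow> ('n qgen list \<Rightarrow>\<^sub>0 complex) set" where
  "tbar_ser q i j r = Uq_ideal q +>\<^bsub>free_algebra\<^esub> Poly_Mapping.single [GenTbar i j r] 1"

definition is_coproduct ::
    "complex
      \<Rightarrow> (('n::{finite,linorder} qgen list \<Rightarrow>\<^sub>0 complex) set
           \<Rightarrow> (('n qgen list \<Rightarrow>\<^sub>0 complex) set \<times> ('n qgen list \<Rightarrow>\<^sub>0 complex) set \<Rightarrow>\<^sub>0 complex) set)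
      \<Rightarrow> bool" where
  "is_coproduct q \<Delta> \<longleftrightarrow>
     \<Delta> \<in> algebra_hom (Uq q) (tensor_algebra (Uq q) (Uq q))
   \<and> (\<forall>i j r. \<Delta> (t_ser q i j r) =
        (\<Oplus>\<^bsub>tensor_algebra (Uq q) (Uq q)\<^esub>k\<in>UNIV. ser_tensor (Uq q) (Uq q) (t_ser q i k) (t_ser q k j) r))
   \<and> (\<forall>i j r. \<Delta> (tbar_ser q i j r) =
        (\<Oplus>\<^bsub>tensor_algebra (Uq q) (Uq q)\<^esub>k\<in>UNIV. ser_tensor (Uq q) (Uq q) (tbar_ser q i k) (tbar_ser q k j) r))"


section \<open>The twisted q-Yangian of orthogonal type\<close>

text \<open>
  The series \<open>s\<^sub>i\<^sub>j(u)\<close> in \<open>u\<^sup>-\<^sup>1\<close>; the coefficient of \<open>u\<^sup>-\<^sup>r\<close> in \<open>tbar\<^sub>j\<^sub>a(u\<^sup>-\<^sup>1)\<close> is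
  \<open>tbar_ser q j a r\<close>.
\<close>

definition s_ser :: "complex \<Rightarrow> 'n::{finite,linorder} \<Rightarrow> 'n \<Rightarrow> nat \<Rightarrow> ('n qgen list \<Rightarrow>\<^sub>0 complex) set" where
  "s_ser q i j r = (\<Oplus>\<^bsub>Uq q\<^esub>a\<in>UNIV. ser_mult (Uq q) (t_ser q i a) (tbar_ser q j a) r)"

definition Ytw :: "complex \<Rightarrow> ('n::{finite,linorder} qgen list \<Rightarrow>\<^sub>0 complex) set set" where
  "Ytw q = gen_subalgebra (Uq q) {s_ser q i j r |i j r. True}"

end

theory Submission imports Defs "HOL-Algebra.UnivPoly" begin

text \<open>
  For series over a tensor product of algebras one has
  \<open>(f \<otimes> f') (g \<otimes> g') = f g \<otimes> f' g'\<close>. Applying \<open>\<Delta>\<close> to \<open>s\<^sub>i\<^sub>j(u) = \<Sum>\<^sub>a t\<^sub>i\<^sub>a(u) tbar\<^sub>j\<^sub>a(u\<^sup>-\<^sup>1)\<close>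
  therefore gives \<open>\<Sum>\<^sub>a\<^sub>k\<^sub>l t\<^sub>i\<^sub>k(u) tbar\<^sub>j\<^sub>l(u\<^sup>-\<^sup>1) \<otimes> t\<^sub>k\<^sub>a(u) tbar\<^sub>l\<^sub>a(u\<^sup>-\<^sup>1)\<close>, and the sum over \<open>a\<close>
  is \<open>s\<^sub>k\<^sub>l(u)\<close> in the second factor. The coideal property follows, since \<open>\<Delta>\<close> is an algebra
  homomorphism and \<open>U \<otimes> Y\<close> is closed under sums, products and scalars.
\<close>

text \<open>Built on \<open>ring\<close>, with no commutativity assumed: \<open>Uq q\<close> and its
  tensor square are to be instances. The last two axioms make the product bilinear, so identities
  can be checked on basis elements.\<close>

locale complex_algebra = ring A for A :: "(complex, 'a) module" (structure) +
  assumes smult_closed [simp]: "x \<in> carrier A \<Longrightarrow> c \<odot> x \<in> carrier A"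
    and smult_l_distr: "x \<in> carrier A \<Longrightarrow> (c + d) \<odot> x = c \<odot> x \<oplus> d \<odot> x"
    and smult_r_distr: "x \<in> carrier A \<Longrightarrow> y \<in> carrier A \<Longrightarrow> c \<odot> (x \<oplus> y) = c \<odot> x \<oplus> c \<odot> y"
    and smult_smult: "x \<in> carrier A \<Longrightarrow> (c * d) \<odot> x = c \<odot> (d \<odot> x)"
    and smult_one: "x \<in> carrier A \<Longrightarrow> 1 \<odot> x = x"
    and smult_mult_left: "x \<in> carrier A \<Longrightarrow> y \<in> carrier A \<Longrightarrow> (c \<odot> x) \<otimes> y = c \<odot> (x \<otimes> y)"
    and smult_mult_right: "x \<in> carrier A \<Longrightarrow> y \<in> carrier A \<Longrightarrow> x \<otimes> (c \<odot> y) = c \<odot> (x \<otimes> y)"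

section \<open>Interchanging finite sums\<close>

section \<open>Finite sums\<close>

text \<open>The inner index set may depend on the outer index, as in Cauchy products. The induction
  peels off one fibre: \<open>Sigma (insert i I) J\<close> is the disjoint union of a copy of
  \<open>J i\<close> and \<open>Sigma I J\<close>.\<close>

lemma (in abelian_monoid) finsum_Sigma:
  assumes "finite I" "\<And>i. i \<in> I \<Longrightarrow> finite (J i)"
    and "\<And>i j. i \<in> I \<Longrightarrow> j \<in> J i \<Longrightarrow> f i j \<in> carrier G"
  shows "(\<Oplus>i\<in>I. \<Oplus>j\<in>J i. f i j) = finsum G (\<lambda>(i, j). f i j) (Sigma I J)"
  using assms
proof (induction I rule: finite_induct)
  case (insert i I)
  have Sigma_insert: "Sigma (insert i I) J = Pair i ` J i \<union> Sigma I J"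
    by auto
  have "(\<Oplus>i\<in>insert i I. \<Oplus>j\<in>J i. f i j) =
      (\<Oplus>j\<in>J i. f i j) \<oplus> (\<Oplus>i\<in>I. \<Oplus>j\<in>J i. f i j)"
    using insert.prems insert.hyps by (intro finsum_insert) (simp_all add: Pi_iff)
  also have "(\<Oplus>j\<in>J i. f i j) = finsum G (case_prod f) (Pair i ` J i)"
    using insert.prems by (subst finsum_reindex) (simp_all add: Pi_iff inj_on_def)
  also have "(\<Oplus>i\<in>I. \<Oplus>j\<in>J i. f i j) = finsum G (case_prod f) (Sigma I J)"
    using insert.prems by (intro insert.IH) simp_all
  also have "finsum G (case_prod f) (Pair i ` J i) \<oplus> finsum G (case_prod f) (Sigma I J) =
      finsum G (case_prod f) (Sigma (insert i I) J)"
    unfolding Sigma_insert using insert.prems insert.hyps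
    by (intro finsum_Un_disjoint[symmetric]) auto
  finally show ?case .
qed simp

lemma (in abelian_monoid) finsum_reindex_bij_betw:
  assumes "bij_betw h I J" "\<And>j. j \<in> J \<Longrightarrow> f j \<in> carrier G"
  shows "(\<Oplus>i\<in>I. f (h i)) = (\<Oplus>j\<in>J. f j)"
  using assms finsum_reindex[of f h I] by (auto simp: bij_betw_def)

text \<open>Both iterated sums flatten to sums over a product set, and \<open>prod.swap\<close>
  matches the two products.\<close>

lemma (in abelian_monoid) finsum_swap:
  assumes "finite I" "finite J" "\<And>i j. i \<in> I \<Longrightarrow> j \<in> J \<Longrightarrow> f i j \<in> carrier G"
  shows "(\<Oplus>i\<in>I. \<Oplus>j\<in>J. f i j) = (\<Oplus>j\<in>J. \<Oplus>i\<in>I. f i j)"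
proof -
  have bij: "bij_betw prod.swap (J \<times> I) (I \<times> J)"
    by (auto simp: bij_betw_def)
  have "(\<Oplus>i\<in>I. \<Oplus>j\<in>J. f i j) = finsum G (\<lambda>(i, j). f i j) (I \<times> J)"
    using assms by (intro finsum_Sigma) auto
  also have "\<dots> = (\<Oplus>x\<in>J \<times> I. case_prod f (prod.swap x))"
    using assms by (intro finsum_reindex_bij_betw[OF bij, symmetric]) auto
  also have "\<dots> = finsum G (\<lambda>(j, i). f i j) (J \<times> I)"
    by (simp add: case_prod_unfold)
  also have "\<dots> = (\<Oplus>j\<in>J. \<Oplus>i\<in>I. f i j)"
    using assms by (intro finsum_Sigma[symmetric]) auto
  finally show ?thesis .
qed

section \<open>The algebra axioms for finitely supported functions on a monoid\<close>

section \<open>Monoid algebras\<close>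

text \<open>\<open>Poly_Mapping.map\<close> applies its function on the support only; since c * 0 =
  0, scaling is still pointwise everywhere.\<close>

lemma lookup_map_times:
  "Poly_Mapping.lookup (Poly_Mapping.map ((*) c) x) k = c * Poly_Mapping.lookup x k"
  for c :: complex
  by (simp add: Poly_Mapping.map.rep_eq when_def)

lemma monoid_algebra_simps [simp]:
  "carrier (monoid_algebra M) = {x. Poly_Mapping.keys x \<subseteq> carrier M}"
  "\<one>\<^bsub>monoid_algebra M\<^esub> = Poly_Mapping.single \<one>\<^bsub>M\<^esub> 1"
  "\<zero>\<^bsub>monoid_algebra M\<^esub> = 0"
  "x \<oplus>\<^bsub>monoid_algebra M\<^esub> y = x + y"
  "c \<odot>\<^bsub>monoid_algebra M\<^esub> x = Poly_Mapping.map ((*) c) x"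
  by (simp_all add: monoid_algebra_def)

text \<open>The definition sums over the supports, which can shrink under addition through
  cancellation. Enlarging the index sets adds only zero terms, so \<open>x\<close>, \<open>y\<close>
  and \<open>x + y\<close> can share one index set in the distributive laws.\<close>

lemma monoid_algebra_mult_superset:
  assumes "finite S" "Poly_Mapping.keys x \<subseteq> S" "finite T" "Poly_Mapping.keys y \<subseteq> T"
  shows "x \<otimes>\<^bsub>monoid_algebra M\<^esub> y = (\<Sum>a\<in>S. \<Sum>b\<in>T.
    Poly_Mapping.single (a \<otimes>\<^bsub>M\<^esub> b) (Poly_Mapping.lookup x a * Poly_Mapping.lookup y b))"
proof -
  have "x \<otimes>\<^bsub>monoid_algebra M\<^esub> y = (\<Sum>a\<in>Poly_Mapping.keys x. \<Sum>b\<in>T.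
      Poly_Mapping.single (a \<otimes>\<^bsub>M\<^esub> b) (Poly_Mapping.lookup x a * Poly_Mapping.lookup y b))"
    unfolding monoid_algebra_def
    using assms by (auto intro!: sum.cong[OF refl] sum.mono_neutral_left simp: in_keys_iff)
  also have "\<dots> = (\<Sum>a\<in>S. \<Sum>b\<in>T.
      Poly_Mapping.single (a \<otimes>\<^bsub>M\<^esub> b) (Poly_Mapping.lookup x a * Poly_Mapping.lookup y b))"
    using assms by (auto intro!: sum.mono_neutral_left simp: in_keys_iff)
  finally show ?thesis .
qed

lemma monoid_algebra_mult_single [simp]:
  "Poly_Mapping.single a c \<otimes>\<^bsub>monoid_algebra M\<^esub> Poly_Mapping.single b d =
     Poly_Mapping.single (a \<otimes>\<^bsub>M\<^esub> b) (c * d)"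
  by (subst monoid_algebra_mult_superset[of "{a}" _ "{b}"]) auto

lemma monoid_algebra_add_mult:
  "(x + y) \<otimes>\<^bsub>monoid_algebra M\<^esub> z = x \<otimes>\<^bsub>monoid_algebra M\<^esub> z + y \<otimes>\<^bsub>monoid_algebra M\<^esub> z"
proof -
  let ?S = "Poly_Mapping.keys x \<union> Poly_Mapping.keys y" and ?T = "Poly_Mapping.keys z"
  have "Poly_Mapping.keys (x + y) \<subseteq> ?S"
    by (rule keys_add)
  then show ?thesis
    by (simp add: monoid_algebra_mult_superset[of ?S _ ?T] lookup_add distrib_right single_add
        sum.distrib)
qed

lemma monoid_algebra_mult_add:
  "z \<otimes>\<^bsub>monoid_algebra M\<^esub> (x + y) = z \<otimes>\<^bsub>monoid_algebra M\<^esub> x + z \<otimes>\<^bsub>monoid_algebra M\<^esub> y"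
proof -
  let ?S = "Poly_Mapping.keys x \<union> Poly_Mapping.keys y" and ?T = "Poly_Mapping.keys z"
  have "Poly_Mapping.keys (x + y) \<subseteq> ?S"
    by (rule keys_add)
  then show ?thesis
    by (simp add: monoid_algebra_mult_superset[of ?T _ ?S] lookup_add distrib_left single_add
        sum.distrib)
qed

lemma monoid_algebra_mult_zero [simp]:
  "0 \<otimes>\<^bsub>monoid_algebra M\<^esub> x = 0" "x \<otimes>\<^bsub>monoid_algebra M\<^esub> 0 = 0"
  by (simp_all add: monoid_algebra_def)

text \<open>An element is the sum of its values on single points of its support. Hence a property
  preserved by sums needs checking only on scaled basis vectors from \<open>S\<close>; this is how
  the multilinear laws below are proved.\<close>

lemma poly_mapping_single_induct [consumes 1, case_names zero single add]:
  fixes x :: "'a \<Rightarrow>\<^sub>0 'b::comm_monoid_add"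
  assumes "Poly_Mapping.keys x \<subseteq> S" "P 0"
    and "\<And>a c. a \<in> S \<Longrightarrow> P (Poly_Mapping.single a c)"
    and "\<And>x y. P x \<Longrightarrow> P y \<Longrightarrow> P (x + y)"
  shows "P x"
proof -
  have "P (\<Sum>a\<in>I. Poly_Mapping.single a (Poly_Mapping.lookup x a))" if "finite I" "I \<subseteq> S" for I
    using that by (induction I rule: finite_induct) (auto intro: assms)
  moreover have "x = (\<Sum>a\<in>Poly_Mapping.keys x. Poly_Mapping.single a (Poly_Mapping.lookup x a))"
    by (rule poly_mapping_eqI)
      (simp add: lookup_sum lookup_single when_def in_keys_iff)
  ultimately show ?thesis
    using assms(1) finite_keys by metis
qed

lemma keys_subset_add:
  "Poly_Mapping.keys x \<subseteq> S \<Longrightarrow> Poly_Mapping.keys y \<subseteq> S \<Longrightarrow> Poly_Mapping.keys (x + y) \<subseteq> S"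
  by (rule order_trans[OF keys_add Un_least])

lemma map_times_add:
  "Poly_Mapping.map ((*) c) (x + y) = Poly_Mapping.map ((*) c) x + Poly_Mapping.map ((*) c) y"
  for c :: complex
  by (rule poly_mapping_eqI) (simp add: lookup_map_times lookup_add distrib_left)

lemma map_add_times:
  "Poly_Mapping.map ((*) (c + d)) x = Poly_Mapping.map ((*) c) x + Poly_Mapping.map ((*) d) x"
  for c :: complex
  by (rule poly_mapping_eqI) (simp add: lookup_map_times lookup_add distrib_right)

lemma map_mult_times:
  "Poly_Mapping.map ((*) (c * d)) x = Poly_Mapping.map ((*) c) (Poly_Mapping.map ((*) d) x)"
  for c :: complex
  by (rule poly_mapping_eqI) (simp add: lookup_map_times mult.assoc)

lemma map_one_times: "Poly_Mapping.map ((*) 1) x = x" for x :: "'a \<Rightarrow>\<^sub>0 complex"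
  by (rule poly_mapping_eqI) (simp add: lookup_map_times)

lemma map_times_single [simp]:
  "Poly_Mapping.map ((*) c) (Poly_Mapping.single a d) = Poly_Mapping.single a (c * d)"
  for c :: complex
  by (rule poly_mapping_eqI) (simp add: lookup_map_times lookup_single when_def)

lemma map_times_zero [simp]: "Poly_Mapping.map ((*) c) 0 = 0" for c :: complex
  by (rule poly_mapping_eqI) (simp add: lookup_map_times)

lemma keys_map_times: "Poly_Mapping.keys (Poly_Mapping.map ((*) c) x) \<subseteq> Poly_Mapping.keys x"
  for c :: complex
  by (auto simp: in_keys_iff lookup_map_times)

text \<open>Closure, associativity, the unit laws and compatibility with scalars are additive in
  each argument. One induction per argument reduces them to scaled basis vectors, where they are the
  laws of \<open>M\<close> and of complex multiplication.\<close>

theorem complex_algebra_monoid_algebra: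
  assumes "Group.monoid M"
  shows "complex_algebra (monoid_algebra M)"
proof -
  interpret M: Group.monoid M by fact
  let ?A = "monoid_algebra M"
  have closed: "Poly_Mapping.keys (x \<otimes>\<^bsub>?A\<^esub> y) \<subseteq> carrier M"
    if "Poly_Mapping.keys x \<subseteq> carrier M" "Poly_Mapping.keys y \<subseteq> carrier M" for x y
    using that(1)
  proof (induction rule: poly_mapping_single_induct)
    case (single a c)
    from that(2) show ?case
    proof (induction rule: poly_mapping_single_induct)
      case (add y z)
      then show ?case
        by (simp add: monoid_algebra_mult_add keys_subset_add)
    qed (use single in simp_all)
  next
    case (add x y)
    then show ?case
      by (simp add: monoid_algebra_add_mult keys_subset_add)
  qed simp
  have assoc: "(x \<otimes>\<^bsub>?A\<^esub> y) \<otimes>\<^bsub>?A\<^esub> z = x \<otimes>\<^bsub>?A\<^esub> (y \<otimes>\<^bsub>?A\<^esub> z)"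
    if "Poly_Mapping.keys x \<subseteq> carrier M" "Poly_Mapping.keys y \<subseteq> carrier M"
      "Poly_Mapping.keys z \<subseteq> carrier M" for x y z
    using that(1)
  proof (induction rule: poly_mapping_single_induct)
    case x: (single a c)
    from that(2) show ?case
    proof (induction rule: poly_mapping_single_induct)
      case y: (single b d)
      from that(3) show ?case
        by (induction rule: poly_mapping_single_induct)
          (use x y in \<open>simp_all add: monoid_algebra_mult_add M.m_assoc mult.assoc\<close>)
    qed (simp_all add: monoid_algebra_mult_add monoid_algebra_add_mult)
  qed (simp_all add: monoid_algebra_add_mult)
  have one: "Poly_Mapping.single \<one>\<^bsub>M\<^esub> 1 \<otimes>\<^bsub>?A\<^esub> x = x" "x \<otimes>\<^bsub>?A\<^esub> Poly_Mapping.single \<one>\<^bsub>M\<^esub> 1 = x"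
    if "Poly_Mapping.keys x \<subseteq> carrier M" for x
    using that by (induction rule: poly_mapping_single_induct)
      (simp_all add: monoid_algebra_mult_add monoid_algebra_add_mult)
  have smult: "Poly_Mapping.map ((*) c) x \<otimes>\<^bsub>?A\<^esub> y = Poly_Mapping.map ((*) c) (x \<otimes>\<^bsub>?A\<^esub> y)"
    "x \<otimes>\<^bsub>?A\<^esub> Poly_Mapping.map ((*) c) y = Poly_Mapping.map ((*) c) (x \<otimes>\<^bsub>?A\<^esub> y)"
    if "Poly_Mapping.keys x \<subseteq> carrier M" "Poly_Mapping.keys y \<subseteq> carrier M" for c x y
  proof -
    show "Poly_Mapping.map ((*) c) x \<otimes>\<^bsub>?A\<^esub> y = Poly_Mapping.map ((*) c) (x \<otimes>\<^bsub>?A\<^esub> y)"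
      using that(1)
    proof (induction rule: poly_mapping_single_induct)
      case (single a c)
      from that(2) show ?case
        by (induction rule: poly_mapping_single_induct)
          (simp_all add: monoid_algebra_mult_add map_times_add mult.assoc)
    qed (simp_all add: monoid_algebra_add_mult map_times_add)
    show "x \<otimes>\<^bsub>?A\<^esub> Poly_Mapping.map ((*) c) y = Poly_Mapping.map ((*) c) (x \<otimes>\<^bsub>?A\<^esub> y)"
      using that(1)
    proof (induction rule: poly_mapping_single_induct)
      case (single a c)
      from that(2) show ?case
        by (induction rule: poly_mapping_single_induct)
          (simp_all add: monoid_algebra_mult_add map_times_add mult.left_commute)
    qed (simp_all add: monoid_algebra_add_mult map_times_add)
  qed
  have "abelian_group ?A"
  proof (rule abelian_groupI)
    fix x assume "x \<in> carrier ?A"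
    then show "\<exists>y\<in>carrier ?A. y \<oplus>\<^bsub>?A\<^esub> x = \<zero>\<^bsub>?A\<^esub>"
      by (intro bexI[of _ "- x"]) auto
  qed (simp_all add: keys_subset_add ac_simps)
  moreover have "Group.monoid ?A"
    by (rule monoidI) (simp_all add: closed assoc one)
  ultimately have "ring ?A"
    by (rule ringI) (simp_all add: monoid_algebra_add_mult monoid_algebra_mult_add)
  moreover have "Poly_Mapping.keys (Poly_Mapping.map ((*) c) x) \<subseteq> carrier M"
    if "Poly_Mapping.keys x \<subseteq> carrier M" for c :: complex and x
    by (rule order_trans[OF keys_map_times that])
  ultimately show ?thesis
    by (intro complex_algebra.intro complex_algebra_axioms.intro)
      (simp_all add: smult map_times_add map_add_times map_mult_times map_one_times)
qed

text \<open>Relations are written with the pointwise difference, whereas equality of cosets is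
  tested with the ring difference; this identifies the two.\<close>

lemma monoid_algebra_minus:
  assumes "Group.monoid M" "x \<in> carrier (monoid_algebra M)" "y \<in> carrier (monoid_algebra M)"
  shows "x \<ominus>\<^bsub>monoid_algebra M\<^esub> y = x - y"
proof -
  interpret complex_algebra "monoid_algebra M"
    using assms(1) by (rule complex_algebra_monoid_algebra)
  have "\<ominus>\<^bsub>monoid_algebra M\<^esub> y = - y"
    by (rule minus_equality) (use assms(3) in auto)
  then show ?thesis
    by (simp add: a_minus_def)
qed

section \<open>Quotients by two-sided ideals, computed on representatives\<close>

section \<open>Quotient algebras\<close>

lemma quot_algebra_simps:
  "carrier (quot_algebra A I) = a_rcosets\<^bsub>A\<^esub> I"
  "X \<otimes>\<^bsub>quot_algebra A I\<^esub> Y = [mod I:] X \<Otimes>\<^bsub>A\<^esub> Y"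
  "\<one>\<^bsub>quot_algebra A I\<^esub> = I +>\<^bsub>A\<^esub> \<one>\<^bsub>A\<^esub>"
  "\<zero>\<^bsub>quot_algebra A I\<^esub> = I"
  "X \<oplus>\<^bsub>quot_algebra A I\<^esub> Y = X <+>\<^bsub>A\<^esub> Y"
  by (simp_all add: quot_algebra_def FactRing_def)

locale algebra_ideal = complex_algebra A + ideal I A for I and A (structure)
begin

text \<open>A ring ideal is automatically a linear subspace, because scaling by \<open>c\<close> is
  multiplication by the element \<open>c \<odot> \<one>\<close>.\<close>

lemma smult_ideal_closed:
  assumes "x \<in> I"
  shows "c \<odot> x \<in> I"
proof -
  have "c \<odot> x = (c \<odot> \<one>) \<otimes> x"
    using assms by (simp add: smult_mult_left Icarr)
  then show ?thesis
    using assms by (simp add: I_l_closed)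
qed

text \<open>The scalar action on the quotient is a union over all representatives. Two
  representatives differ by an element of \<open>I\<close>, which scaling keeps in \<open>I\<close>,
  so the united cosets all coincide.\<close>

lemma quot_smult_coset:
  assumes "x \<in> carrier A"
  shows "c \<odot>\<^bsub>quot_algebra A I\<^esub> (I +> x) = I +> c \<odot> x"
proof -
  have "I +> c \<odot> y = I +> c \<odot> x" if y: "y \<in> I +> x" for y
  proof -
    obtain h where h: "h \<in> I" "y = h \<oplus> x"
      using y by (auto simp: a_r_coset_def r_coset_def)
    then have "c \<odot> y = c \<odot> h \<oplus> c \<odot> x"
      using assms by (simp add: smult_r_distr Icarr)
    then have "c \<odot> y \<in> I +> c \<odot> x"
      using smult_ideal_closed[OF h(1)] by (auto simp: a_r_coset_def r_coset_def)
    then show ?thesis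
      using a_repr_independence' assms by simp
  qed
  then have "(\<Union>y\<in>I +> x. I +> c \<odot> y) = (\<Union>y\<in>I +> x. I +> c \<odot> x)"
    by (intro SUP_cong refl)
  \<comment> \<open>A union of a constant family equals that constant only over a nonempty index
    set; \<open>x\<close> itself is a member.\<close>
  also have "\<dots> = I +> c \<odot> x"
    using a_rcos_self[OF assms] by auto
  finally show ?thesis
    by (simp add: quot_algebra_def)
qed

lemma coset_in_quot [simp]: "x \<in> carrier A \<Longrightarrow> I +> x \<in> carrier (quot_algebra A I)"
  by (simp add: quot_algebra_simps a_rcosetsI a_subset)

lemma quot_cases:
  assumes "X \<in> carrier (quot_algebra A I)"
  obtains x where "x \<in> carrier A" "X = I +> x"
  using assms by (auto simp: quot_algebra_simps A_RCOSETS_defs a_r_coset_def)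

lemma quot_mult_coset:
  "x \<in> carrier A \<Longrightarrow> y \<in> carrier A \<Longrightarrow>
    (I +> x) \<otimes>\<^bsub>quot_algebra A I\<^esub> (I +> y) = I +> x \<otimes> y"
  by (simp add: quot_algebra_simps rcoset_mult_add)

lemma quot_add_coset:
  "x \<in> carrier A \<Longrightarrow> y \<in> carrier A \<Longrightarrow>
    (I +> x) \<oplus>\<^bsub>quot_algebra A I\<^esub> (I +> y) = I +> (x \<oplus> y)"
  by (simp add: quot_algebra_simps a_rcos_sum)

lemma coset_eqI:
  assumes "x \<in> carrier A" "y \<in> carrier A" "x \<ominus> y \<in> I"
  shows "I +> x = I +> y"
proof -
  have "x = (x \<ominus> y) \<oplus> y"
    using assms by (simp add: a_minus_def a_assoc l_neg)
  then have "x \<in> I +> y"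
    using assms(3) by (auto simp: a_r_coset_def r_coset_def)
  then show ?thesis
    using a_repr_independence' assms(2) by simp
qed

theorem complex_algebra_quot: "complex_algebra (quot_algebra A I)"
proof -
  let ?Q = "quot_algebra A I"
  \<comment> \<open>The zero of the quotient is \<open>I\<close> itself; written as a coset it
    becomes accessible to the representative rules.\<close>
  have zero: "\<zero>\<^bsub>?Q\<^esub> = I +> \<zero>"
    by (simp add: quot_algebra_simps a_rcos_const)
  have "abelian_group ?Q"
  proof (rule abelian_groupI)
    fix X Y Z assume "X \<in> carrier ?Q" "Y \<in> carrier ?Q" "Z \<in> carrier ?Q"
    then show "X \<oplus>\<^bsub>?Q\<^esub> Y \<oplus>\<^bsub>?Q\<^esub> Z = X \<oplus>\<^bsub>?Q\<^esub> (Y \<oplus>\<^bsub>?Q\<^esub> Z)"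
      by (elim quot_cases) (simp add: quot_add_coset a_assoc)
  next
    fix X Y assume "X \<in> carrier ?Q" "Y \<in> carrier ?Q"
    then show "X \<oplus>\<^bsub>?Q\<^esub> Y \<in> carrier ?Q" "X \<oplus>\<^bsub>?Q\<^esub> Y = Y \<oplus>\<^bsub>?Q\<^esub> X"
      by (elim quot_cases; simp add: quot_add_coset a_comm)+
  next
    fix X assume "X \<in> carrier ?Q"
    then obtain x where x: "x \<in> carrier A" "X = I +> x"
      by (rule quot_cases)
    then show "\<zero>\<^bsub>?Q\<^esub> \<oplus>\<^bsub>?Q\<^esub> X = X"
      by (simp add: zero quot_add_coset)
    show "\<exists>Y\<in>carrier ?Q. Y \<oplus>\<^bsub>?Q\<^esub> X = \<zero>\<^bsub>?Q\<^esub>"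
      using x by (intro bexI[of _ "I +> \<ominus> x"]) (simp_all add: zero quot_add_coset l_neg)
  qed (simp add: zero)
  moreover have "Group.monoid ?Q"
  proof (rule monoidI)
    fix X Y Z assume "X \<in> carrier ?Q" "Y \<in> carrier ?Q" "Z \<in> carrier ?Q"
    then show "X \<otimes>\<^bsub>?Q\<^esub> Y \<otimes>\<^bsub>?Q\<^esub> Z = X \<otimes>\<^bsub>?Q\<^esub> (Y \<otimes>\<^bsub>?Q\<^esub> Z)"
      by (elim quot_cases) (simp add: quot_mult_coset m_assoc)
  qed (auto elim!: quot_cases simp: quot_mult_coset quot_algebra_simps(3))
  ultimately have "ring ?Q"
  proof (rule ringI)
    fix X Y Z assume "X \<in> carrier ?Q" "Y \<in> carrier ?Q" "Z \<in> carrier ?Q"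
    then show "(X \<oplus>\<^bsub>?Q\<^esub> Y) \<otimes>\<^bsub>?Q\<^esub> Z = X \<otimes>\<^bsub>?Q\<^esub> Z \<oplus>\<^bsub>?Q\<^esub> Y \<otimes>\<^bsub>?Q\<^esub> Z"
      "Z \<otimes>\<^bsub>?Q\<^esub> (X \<oplus>\<^bsub>?Q\<^esub> Y) = Z \<otimes>\<^bsub>?Q\<^esub> X \<oplus>\<^bsub>?Q\<^esub> Z \<otimes>\<^bsub>?Q\<^esub> Y"
      by (elim quot_cases; simp add: quot_mult_coset quot_add_coset l_distr r_distr)+
  qed
  moreover have "complex_algebra_axioms ?Q"
    by (rule complex_algebra_axioms.intro; elim quot_cases)
      (simp_all add: quot_mult_coset quot_add_coset quot_smult_coset smult_l_distr
        smult_r_distr smult_smult smult_one smult_mult_left smult_mult_right)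
  ultimately show ?thesis
    by (rule complex_algebra.intro)
qed

end


section \<open>The tensor product of two algebras and its pure tensors\<close>

section \<open>Tensor products\<close>

locale algebra_pair = A: complex_algebra A + B: complex_algebra B
  for A :: "(complex, 'a) module" and B :: "(complex, 'b) module"
begin

abbreviation "T \<equiv> tensor_algebra A B"

lemma monoid_pair: "Group.monoid (A \<times>\<times> B)"
  by (rule DirProd_monoid) (rule A.monoid_axioms B.monoid_axioms)+

lemma single_in_pair [simp]:
  "a \<in> carrier A \<Longrightarrow> b \<in> carrier B \<Longrightarrow> Poly_Mapping.single (a, b) c \<in> carrier (pair_algebra A B)"
  by (simp add: pair_algebra_def)

text \<open>Both facts used about the generated ideal, that it is an ideal and that it contains its
  generators, require the generators to lie in the carrier.\<close>

lemma bilinear_rels_subset: "bilinear_rels A B \<subseteq> carrier (pair_algebra A B)"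
  unfolding bilinear_rels_def Let_def pair_algebra_def 
  by (auto dest!: subsetD[OF keys_diff] split: if_splits)

lemma algebra_ideal_bilinear: "algebra_ideal (bilinear_ideal A B) (pair_algebra A B)"
proof -
  interpret P: complex_algebra "pair_algebra A B"
    unfolding pair_algebra_def by (rule complex_algebra_monoid_algebra[OF monoid_pair])
  show ?thesis
    unfolding bilinear_ideal_def
    by (intro algebra_ideal.intro P.complex_algebra_axioms P.genideal_ideal bilinear_rels_subset)
qed

sublocale P: algebra_ideal "bilinear_ideal A B" "pair_algebra A B"
  by (rule algebra_ideal_bilinear)

sublocale T: complex_algebra T
  unfolding tensor_algebra_def by (rule P.complex_algebra_quot)

lemma tensor_closed [simp]: "a \<in> carrier A \<Longrightarrow> b \<in> carrier B \<Longrightarrow> tensor A B a b \<in> carrier T"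
  by (simp add: tensor_def tensor_algebra_def)

lemma tensor_mult:
  "a \<in> carrier A \<Longrightarrow> b \<in> carrier B \<Longrightarrow> a' \<in> carrier A \<Longrightarrow> b' \<in> carrier B \<Longrightarrow>
    tensor A B a b \<otimes>\<^bsub>T\<^esub> tensor A B a' b' = tensor A B (a \<otimes>\<^bsub>A\<^esub> a') (b \<otimes>\<^bsub>B\<^esub> b')"
  by (simp add: tensor_def tensor_algebra_def P.quot_mult_coset)
    (simp add: pair_algebra_def)

lemma tensor_one: "tensor A B \<one>\<^bsub>A\<^esub> \<one>\<^bsub>B\<^esub> = \<one>\<^bsub>T\<^esub>"
  by (simp add: tensor_def tensor_algebra_def quot_algebra_simps pair_algebra_def)

text \<open>Turns a generator of the bilinear ideal, read as a difference, into an equation in the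
  tensor product.\<close>

lemma bilinear_rel_coset_eq:
  assumes "x - y \<in> bilinear_rels A B" "x \<in> carrier (pair_algebra A B)"
    "y \<in> carrier (pair_algebra A B)"
  shows "bilinear_ideal A B +>\<^bsub>pair_algebra A B\<^esub> x = bilinear_ideal A B +>\<^bsub>pair_algebra A B\<^esub> y"
proof (rule P.coset_eqI)
  have "x \<ominus>\<^bsub>pair_algebra A B\<^esub> y = x - y"
    using assms monoid_algebra_minus[OF monoid_pair] by (simp add: pair_algebra_def)
  then show "x \<ominus>\<^bsub>pair_algebra A B\<^esub> y \<in> bilinear_ideal A B"
    using P.genideal_self[OF bilinear_rels_subset] assms(1) by (auto simp: bilinear_ideal_def)
qed (use assms in simp_all)

lemma tensor_add_left:
  assumes "a \<in> carrier A" "a' \<in> carrier A" "b \<in> carrier B"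
  shows "tensor A B (a \<oplus>\<^bsub>A\<^esub> a') b = tensor A B a b \<oplus>\<^bsub>T\<^esub> tensor A B a' b"
proof -
  let ?d = "\<lambda>a b. Poly_Mapping.single (a, b) (1::complex)"
  have "?d (a \<oplus>\<^bsub>A\<^esub> a') b - ?d a b - ?d a' b \<in> bilinear_rels A B"
    unfolding bilinear_rels_def Let_def using assms by blast
  \<comment> \<open>The generator has the form a - b - c; \<open>diff_diff_eq\<close> regroups it as
    a - (b + c), the difference of two elements that \<open>bilinear_rel_coset_eq\<close>
    expects.\<close>
  then have "tensor A B (a \<oplus>\<^bsub>A\<^esub> a') b =
      bilinear_ideal A B +>\<^bsub>pair_algebra A B\<^esub> (?d a b \<oplus>\<^bsub>pair_algebra A B\<^esub> ?d a' b)"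
    unfolding tensor_def using assms
    by (intro bilinear_rel_coset_eq P.a_closed) (simp_all add: pair_algebra_def diff_diff_eq keys_subset_add)
  then show ?thesis
    using assms by (simp add: tensor_def tensor_algebra_def P.quot_add_coset)
qed

lemma tensor_add_right:
  assumes "a \<in> carrier A" "b \<in> carrier B" "b' \<in> carrier B"
  shows "tensor A B a (b \<oplus>\<^bsub>B\<^esub> b') = tensor A B a b \<oplus>\<^bsub>T\<^esub> tensor A B a b'"
proof -
  let ?d = "\<lambda>a b. Poly_Mapping.single (a, b) (1::complex)"
  have "?d a (b \<oplus>\<^bsub>B\<^esub> b') - ?d a b - ?d a b' \<in> bilinear_rels A B"
    unfolding bilinear_rels_def Let_def using assms by blast
  then have "tensor A B a (b \<oplus>\<^bsub>B\<^esub> b') =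
      bilinear_ideal A B +>\<^bsub>pair_algebra A B\<^esub> (?d a b \<oplus>\<^bsub>pair_algebra A B\<^esub> ?d a b')"
    unfolding tensor_def using assms
    by (intro bilinear_rel_coset_eq P.a_closed) (simp_all add: pair_algebra_def diff_diff_eq keys_subset_add)
  then show ?thesis
    using assms by (simp add: tensor_def tensor_algebra_def P.quot_add_coset)
qed

text \<open>Additivity applied to 0 + 0 = 0 gives z = z + z for this tensor z, and cancellation
  leaves z = 0.\<close>

lemma tensor_zero_left: "b \<in> carrier B \<Longrightarrow> tensor A B \<zero>\<^bsub>A\<^esub> b = \<zero>\<^bsub>T\<^esub>"
  using tensor_add_left[of "\<zero>\<^bsub>A\<^esub>" "\<zero>\<^bsub>A\<^esub>" b] by (simp add: T.add.r_cancel_one')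

lemma tensor_zero_right: "a \<in> carrier A \<Longrightarrow> tensor A B a \<zero>\<^bsub>B\<^esub> = \<zero>\<^bsub>T\<^esub>"
  using tensor_add_right[of a "\<zero>\<^bsub>B\<^esub>" "\<zero>\<^bsub>B\<^esub>"] by (simp add: T.add.r_cancel_one')

lemma tensor_finsum_left:
  assumes "finite I" "f \<in> I \<rightarrow> carrier A" "b \<in> carrier B"
  shows "tensor A B (\<Oplus>\<^bsub>A\<^esub>i\<in>I. f i) b = (\<Oplus>\<^bsub>T\<^esub>i\<in>I. tensor A B (f i) b)"
  using assms
  by (induction I rule: finite_induct)
    (simp_all add: tensor_zero_left tensor_add_left Pi_iff)

lemma tensor_finsum_right:
  assumes "finite I" "f \<in> I \<rightarrow> carrier B" "a \<in> carrier A"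
  shows "tensor A B a (\<Oplus>\<^bsub>B\<^esub>i\<in>I. f i) = (\<Oplus>\<^bsub>T\<^esub>i\<in>I. tensor A B a (f i))"
  using assms
  by (induction I rule: finite_induct)
    (simp_all add: tensor_zero_right tensor_add_right Pi_iff)

section \<open>Subspaces spanned by pure tensors\<close>

lemma tensor_subspace_subset:
  assumes "V \<subseteq> carrier A" "W \<subseteq> carrier B"
  shows "tensor_subspace A B V W \<subseteq> carrier T"
proof
  fix z assume "z \<in> tensor_subspace A B V W"
  then show "z \<in> carrier T"
    unfolding tensor_subspace_def
  proof induction
    case (incl z)
    then show ?case
      using assms by (auto simp: subset_iff)
  qed simp_all
qed

text \<open>By bilinearity it is enough to multiply pure tensors, and these multiply componentwise
  within \<open>V\<close> and \<open>W\<close>. The two spans are handled in turn: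
  \<open>mult_gen\<close> fixes a pure tensor on the left and varies the right factor, then the left
  factor varies.\<close>

lemma tensor_subspace_mult_closed:
  assumes V: "V \<subseteq> carrier A" "\<And>v v'. v \<in> V \<Longrightarrow> v' \<in> V \<Longrightarrow> v \<otimes>\<^bsub>A\<^esub> v' \<in> V"
    and W: "W \<subseteq> carrier B" "\<And>w w'. w \<in> W \<Longrightarrow> w' \<in> W \<Longrightarrow> w \<otimes>\<^bsub>B\<^esub> w' \<in> W"
    and x: "x \<in> tensor_subspace A B V W" and y: "y \<in> tensor_subspace A B V W"
  shows "x \<otimes>\<^bsub>T\<^esub> y \<in> tensor_subspace A B V W"
proof -
  let ?S = "{tensor A B v w |v w. v \<in> V \<and> w \<in> W}"
  have span_carrier: "z \<in> carrier T" if "z \<in> lin_span T ?S" for z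
    using tensor_subspace_subset[OF V(1) W(1)] that by (auto simp: tensor_subspace_def)
  have mult_gen: "x \<otimes>\<^bsub>T\<^esub> y \<in> lin_span T ?S" if x: "x \<in> ?S" and y: "y \<in> lin_span T ?S" for x y
    using y
  proof induction
    case zero
    show ?case
      using span_carrier[OF lin_span.incl[OF x]] by (simp add: lin_span.zero)
  next
    case (incl y)
    obtain v w v' w' where "x = tensor A B v w" "y = tensor A B v' w'"
      "v \<in> V" "v' \<in> V" "w \<in> W" "w' \<in> W"
      using x incl by auto
    moreover from this have "x \<otimes>\<^bsub>T\<^esub> y = tensor A B (v \<otimes>\<^bsub>A\<^esub> v') (w \<otimes>\<^bsub>B\<^esub> w')"
      using V(1) W(1) by (simp add: tensor_mult subset_iff)
    ultimately have "x \<otimes>\<^bsub>T\<^esub> y \<in> ?S"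
      using V(2) W(2) by blast
    then show ?case
      by (rule lin_span.incl)
  next
    case (add y z)
    then have "x \<otimes>\<^bsub>T\<^esub> (y \<oplus>\<^bsub>T\<^esub> z) = x \<otimes>\<^bsub>T\<^esub> y \<oplus>\<^bsub>T\<^esub> x \<otimes>\<^bsub>T\<^esub> z"
      using lin_span.incl[OF x] by (intro T.r_distr span_carrier)
    then show ?case
      using add by (simp add: lin_span.add)
  next
    case (smult y c)
    then have "x \<otimes>\<^bsub>T\<^esub> (c \<odot>\<^bsub>T\<^esub> y) = c \<odot>\<^bsub>T\<^esub> (x \<otimes>\<^bsub>T\<^esub> y)"
      using lin_span.incl[OF x] by (intro T.smult_mult_right span_carrier)
    then show ?case
      using smult by (simp add: lin_span.smult)
  qed
  have y: "y \<in> lin_span T ?S"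
    using y by (simp add: tensor_subspace_def)
  from x have "x \<in> lin_span T ?S"
    by (simp add: tensor_subspace_def)
  then have "x \<otimes>\<^bsub>T\<^esub> y \<in> lin_span T ?S"
  proof induction
    case zero
    show ?case
      using lin_span.zero span_carrier[OF y] by auto
  next
    case (incl x)
    then show ?case
      using mult_gen y by blast
  next
    case (add x z)
    then have "(x \<oplus>\<^bsub>T\<^esub> z) \<otimes>\<^bsub>T\<^esub> y = x \<otimes>\<^bsub>T\<^esub> y \<oplus>\<^bsub>T\<^esub> z \<otimes>\<^bsub>T\<^esub> y"
      using y by (intro T.l_distr span_carrier)
    then show ?case
      using add by (simp add: lin_span.add)
  next
    case (smult x c)
    then have "(c \<odot>\<^bsub>T\<^esub> x) \<otimes>\<^bsub>T\<^esub> y = c \<odot>\<^bsub>T\<^esub> (x \<otimes>\<^bsub>T\<^esub> y)"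
      using y by (intro T.smult_mult_left span_carrier)
    then show ?case
      using smult by (simp add: lin_span.smult)
  qed
  then show ?thesis
    by (simp add: tensor_subspace_def)
qed

text \<open>Used for the sums over indices and for the Cauchy sum inside \<open>ser_tensor\<close>
  alike.\<close>

lemma finsum_in_tensor_subspace:
  assumes "finite I" "\<And>i. i \<in> I \<Longrightarrow> f i \<in> tensor_subspace A B V W"
    and "V \<subseteq> carrier A" "W \<subseteq> carrier B"
  shows "(\<Oplus>\<^bsub>T\<^esub>i\<in>I. f i) \<in> tensor_subspace A B V W"
proof -
  note carrier = subsetD[OF tensor_subspace_subset[OF assms(3,4)]]
  from assms(1,2) show ?thesis
  proof (induction I rule: finite_induct)
    case empty
    then show ?case
      by (simp add: tensor_subspace_def lin_span.zero)
  next
    case (insert i I)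
    moreover from insert.prems have "f \<in> I \<rightarrow> carrier T" "f i \<in> carrier T"
      by (auto intro: carrier)
    ultimately show ?case
      by (simp add: tensor_subspace_def lin_span.add)
  qed
qed

end

section \<open>Cauchy products and tensor products of formal series\<close>

section \<open>Formal series\<close>

context complex_algebra
begin

lemma ser_mult_closed [simp]:
  "range f \<subseteq> carrier A \<Longrightarrow> range g \<subseteq> carrier A \<Longrightarrow> ser_mult A f g r \<in> carrier A"
  unfolding ser_mult_def by (intro finsum_closed) (auto simp: image_subset_iff)

text \<open>Distributivity is applied to each term of the Cauchy sum, and \<open>finsum_swap\<close>
  then moves the sum over \<open>I\<close> outside.\<close>

lemma ser_mult_finsum_left:
  assumes "finite I" "\<And>i r. i \<in> I \<Longrightarrow> f i r \<in> carrier A" "\<And>r. g r \<in> carrier A"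
  shows "ser_mult A (\<lambda>r. \<Oplus>i\<in>I. f i r) g r = (\<Oplus>i\<in>I. ser_mult A (f i) g r)"
proof -
  have "ser_mult A (\<lambda>r. \<Oplus>i\<in>I. f i r) g r = (\<Oplus>p\<in>{..r}. \<Oplus>i\<in>I. f i p \<otimes> g (r - p))"
    unfolding ser_mult_def using assms
    by (intro finsum_cong' refl finsum_ldistr) (auto intro!: finsum_closed)
  also have "\<dots> = (\<Oplus>i\<in>I. ser_mult A (f i) g r)"
    unfolding ser_mult_def using assms by (intro finsum_swap) auto
  finally show ?thesis .
qed

lemma ser_mult_finsum_right:
  assumes "finite I" "\<And>i r. i \<in> I \<Longrightarrow> f i r \<in> carrier A" "\<And>r. g r \<in> carrier A"
  shows "ser_mult A g (\<lambda>r. \<Oplus>i\<in>I. f i r) r = (\<Oplus>i\<in>I. ser_mult A g (f i) r)"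
proof -
  have "ser_mult A g (\<lambda>r. \<Oplus>i\<in>I. f i r) r = (\<Oplus>p\<in>{..r}. \<Oplus>i\<in>I. g p \<otimes> f i (r - p))"
    unfolding ser_mult_def using assms
    by (intro finsum_cong' refl finsum_rdistr) (auto intro!: finsum_closed)
  also have "\<dots> = (\<Oplus>i\<in>I. ser_mult A g (f i) r)"
    unfolding ser_mult_def using assms by (intro finsum_swap) auto
  finally show ?thesis .
qed

end

context algebra_pair
begin

lemma ser_tensor_closed [simp]:
  "range f \<subseteq> carrier A \<Longrightarrow> range g \<subseteq> carrier B \<Longrightarrow> ser_tensor A B f g r \<in> carrier T"
  unfolding ser_tensor_def by (intro T.finsum_closed) (auto simp: image_subset_iff)

text \<open>Needed to gather the products of series in the second tensor factor into
  \<open>s_ser\<close>.\<close>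

lemma ser_tensor_finsum_right:
  assumes "finite I" "\<And>i r. i \<in> I \<Longrightarrow> f i r \<in> carrier B" "\<And>r. g r \<in> carrier A"
  shows "ser_tensor A B g (\<lambda>r. \<Oplus>\<^bsub>B\<^esub>i\<in>I. f i r) r = (\<Oplus>\<^bsub>T\<^esub>i\<in>I. ser_tensor A B g (f i) r)"
proof -
  have "ser_tensor A B g (\<lambda>r. \<Oplus>\<^bsub>B\<^esub>i\<in>I. f i r) r =
      (\<Oplus>\<^bsub>T\<^esub>p\<in>{..r}. \<Oplus>\<^bsub>T\<^esub>i\<in>I. tensor A B (g p) (f i (r - p)))"
    unfolding ser_tensor_def using assms
    by (intro T.finsum_cong' refl tensor_finsum_right) (auto intro!: T.finsum_closed)
  also have "\<dots> = (\<Oplus>\<^bsub>T\<^esub>i\<in>I. ser_tensor A B g (f i) r)"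
    unfolding ser_tensor_def using assms by (intro T.finsum_swap) auto
  finally show ?thesis .
qed

text \<open>Both coefficients sum the same terms over all x + x' + y + y' = r, where these are the
  exponents taken from f, f', g, g'. The left side groups them as (x + x') + (y + y'), the right
  side as (x + y) + (x' + y'), so a reindexing suffices.\<close>

theorem ser_mult_ser_tensor:
  assumes f: "range f \<subseteq> carrier A" and f': "range f' \<subseteq> carrier B"
    and g: "range g \<subseteq> carrier A" and g': "range g' \<subseteq> carrier B"
  shows "ser_mult T (ser_tensor A B f f') (ser_tensor A B g g') r =
    ser_tensor A B (ser_mult A f g) (ser_mult B f' g') r"
proof -
  define G where "G x x' y y' = tensor A B (f x \<otimes>\<^bsub>A\<^esub> g y) (f' x' \<otimes>\<^bsub>B\<^esub> g' y')" for x x' y y'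
  \<comment> \<open>A triple records the total of the first group and one exponent from each group;
    the other two exponents are differences. The left side reads it as (x + x', x, y), the right
    side as (x + y, x, x').\<close>
  define D where "D = (SIGMA p:{..r}. {..p} \<times> {..r - p})"
  \<comment> \<open>\<open>h\<close> is an involution of \<open>D\<close> exchanging the two ways of splitting \<open>r = x + x' + y + y'\<close>.\<close>
  define h :: "nat \<times> nat \<times> nat \<Rightarrow> nat \<times> nat \<times> nat" where "h = (\<lambda>(p, x, y). (x + y, x, p - x))"
  note carr [simp] = f[unfolded image_subset_iff, simplified] f'[unfolded image_subset_iff, simplified]
    g[unfolded image_subset_iff, simplified] g'[unfolded image_subset_iff, simplified]
  have G [simp]: "G x x' y y' \<in> carrier T" for x x' y y'
    by (simp add: G_def)
  \<comment> \<open>Stated for arbitrary \<open>F\<close>, because both groupings range over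
    \<open>D\<close> and are flattened in the same way.\<close>
  have triple: "(\<Oplus>\<^bsub>T\<^esub>p\<in>{..r}. \<Oplus>\<^bsub>T\<^esub>x\<in>{..p}. \<Oplus>\<^bsub>T\<^esub>y\<in>{..r - p}. F p x y) =
      finsum T (\<lambda>(p, x, y). F p x y) D" if [simp]: "\<And>p x y. F p x y \<in> carrier T" for F
  proof -
    have "(\<Oplus>\<^bsub>T\<^esub>p\<in>{..r}. \<Oplus>\<^bsub>T\<^esub>x\<in>{..p}. \<Oplus>\<^bsub>T\<^esub>y\<in>{..r - p}. F p x y) =
        (\<Oplus>\<^bsub>T\<^esub>p\<in>{..r}. finsum T (\<lambda>(x, y). F p x y) ({..p} \<times> {..r - p}))"
      by (intro T.finsum_cong' refl T.finsum_Sigma) (auto intro!: T.finsum_closed)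
    also have "\<dots> = finsum T (\<lambda>(p, x, y). F p x y) D"
      unfolding D_def by (intro T.finsum_Sigma) auto
    finally show ?thesis .
  qed
  have "ser_mult T (ser_tensor A B f f') (ser_tensor A B g g') r =
      (\<Oplus>\<^bsub>T\<^esub>p\<in>{..r}. \<Oplus>\<^bsub>T\<^esub>x\<in>{..p}. \<Oplus>\<^bsub>T\<^esub>y\<in>{..r - p}. G x (p - x) y (r - p - y))"
    unfolding ser_mult_def
  proof (intro T.finsum_cong' refl)
    fix p
    have "ser_tensor A B f f' p \<otimes>\<^bsub>T\<^esub> ser_tensor A B g g' (r - p) =
        (\<Oplus>\<^bsub>T\<^esub>x\<in>{..p}. tensor A B (f x) (f' (p - x)) \<otimes>\<^bsub>T\<^esub> ser_tensor A B g g' (r - p))"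
      \<comment> \<open>Only the left factor is expanded; the right one stays whole until the next
        step.\<close>
      unfolding ser_tensor_def[of _ _ f]
      by (intro T.finsum_ldistr) (auto simp: f f' g g')
    also have "\<dots> = (\<Oplus>\<^bsub>T\<^esub>x\<in>{..p}. \<Oplus>\<^bsub>T\<^esub>y\<in>{..r - p}. G x (p - x) y (r - p - y))"
    proof (intro T.finsum_cong' refl)
      fix x
      have "tensor A B (f x) (f' (p - x)) \<otimes>\<^bsub>T\<^esub> ser_tensor A B g g' (r - p) =
          (\<Oplus>\<^bsub>T\<^esub>y\<in>{..r - p}. tensor A B (f x) (f' (p - x)) \<otimes>\<^bsub>T\<^esub> tensor A B (g y) (g' (r - p - y)))"
        unfolding ser_tensor_def by (intro T.finsum_rdistr) auto
      then show "tensor A B (f x) (f' (p - x)) \<otimes>\<^bsub>T\<^esub> ser_tensor A B g g' (r - p) =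
          (\<Oplus>\<^bsub>T\<^esub>y\<in>{..r - p}. G x (p - x) y (r - p - y))"
        by (simp add: tensor_mult G_def)
    qed (auto intro!: T.finsum_closed)
    finally show "ser_tensor A B f f' p \<otimes>\<^bsub>T\<^esub> ser_tensor A B g g' (r - p) =
        (\<Oplus>\<^bsub>T\<^esub>x\<in>{..p}. \<Oplus>\<^bsub>T\<^esub>y\<in>{..r - p}. G x (p - x) y (r - p - y))" .
  qed (auto intro!: T.finsum_closed)
  also have "\<dots> = finsum T (\<lambda>(p, x, y). G x (p - x) y (r - p - y)) D"
    by (rule triple) simp
  \<comment> \<open>At \<open>h (p, x, y)\<close> the exponents are x, p - x, (x + y) - x = y and r
    - (x + y) - (p - x) = r - p - y. The last equality of truncated differences uses x \<le> p,
    which holds on \<open>D\<close>.\<close>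
  also have "\<dots> = (\<Oplus>\<^bsub>T\<^esub>d\<in>D. (\<lambda>(p, x, x'). G x x' (p - x) (r - p - x')) (h d))"
    by (rule T.finsum_cong') (auto simp: D_def h_def add.commute)
  also have "\<dots> = finsum T (\<lambda>(p, x, x'). G x x' (p - x) (r - p - x')) D"
  proof (rule T.finsum_reindex_bij_betw)
    show "bij_betw h D D"
      by (rule bij_betw_byWitness[of _ h]) (auto simp: D_def h_def)
  qed auto
  also have "\<dots> = (\<Oplus>\<^bsub>T\<^esub>p\<in>{..r}. \<Oplus>\<^bsub>T\<^esub>x\<in>{..p}. \<Oplus>\<^bsub>T\<^esub>x'\<in>{..r - p}. G x x' (p - x) (r - p - x'))"
    by (rule triple[symmetric]) simp
  also have "\<dots> = ser_tensor A B (ser_mult A f g) (ser_mult B f' g') r"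
    unfolding ser_tensor_def
  proof (intro T.finsum_cong' refl)
    fix p
    have "tensor A B (ser_mult A f g p) (ser_mult B f' g' (r - p)) =
        (\<Oplus>\<^bsub>T\<^esub>x\<in>{..p}. tensor A B (f x \<otimes>\<^bsub>A\<^esub> g (p - x)) (ser_mult B f' g' (r - p)))"
      unfolding ser_mult_def[of A] by (intro tensor_finsum_left) (auto simp: f' g')
    also have "\<dots> = (\<Oplus>\<^bsub>T\<^esub>x\<in>{..p}. \<Oplus>\<^bsub>T\<^esub>x'\<in>{..r - p}. G x x' (p - x) (r - p - x'))"
      unfolding ser_mult_def G_def
      by (intro T.finsum_cong' refl tensor_finsum_right) (auto intro!: T.finsum_closed)
    finally show "(\<Oplus>\<^bsub>T\<^esub>x\<in>{..p}. \<Oplus>\<^bsub>T\<^esub>x'\<in>{..r - p}. G x x' (p - x) (r - p - x')) =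
        tensor A B (ser_mult A f g p) (ser_mult B f' g' (r - p))" by simp
  qed (auto simp: f f' g g')
  finally show ?thesis .
qed

end

section \<open>The quantum affine algebra and the coideal property\<close>

section \<open>The twisted q-Yangian\<close>

text \<open>\<open>free_algebra\<close> is the monoid algebra of words under concatenation. Its
  carrier is the whole type, so the defining relations lie in it at once and generate an
  ideal.\<close>

lemma algebra_ideal_Uq:
  "algebra_ideal (Uq_ideal q :: ('n::{finite,linorder} qgen list \<Rightarrow>\<^sub>0 complex) set) free_algebra"
proof -
  have "Group.monoid \<lparr>carrier = UNIV, mult = (@), one = []\<rparr>"
    by (rule monoidI) auto
  then interpret F: complex_algebra "free_algebra :: (complex, 'n qgen list \<Rightarrow>\<^sub>0 complex) module"
    unfolding free_algebra_def by (rule complex_algebra_monoid_algebra)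
  show ?thesis
    unfolding Uq_ideal_def
    by (intro algebra_ideal.intro F.complex_algebra_axioms F.genideal_ideal)
      (simp add: free_algebra_def)
qed

lemma complex_algebra_Uq: "complex_algebra (Uq q)"
  unfolding Uq_def by (rule algebra_ideal.complex_algebra_quot[OF algebra_ideal_Uq])

lemma t_ser_closed [simp]: "t_ser q i j r \<in> carrier (Uq q)"
  unfolding t_ser_def Uq_def
  by (rule algebra_ideal.coset_in_quot[OF algebra_ideal_Uq]) (simp add: free_algebra_def)

lemma tbar_ser_closed [simp]: "tbar_ser q i j r \<in> carrier (Uq q)"
  unfolding tbar_ser_def Uq_def
  by (rule algebra_ideal.coset_in_quot[OF algebra_ideal_Uq]) (simp add: free_algebra_def)

lemma s_ser_closed [simp]: "s_ser q i j r \<in> carrier (Uq q)"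
proof -
  interpret U: complex_algebra "Uq q :: (complex, ('a qgen list \<Rightarrow>\<^sub>0 complex) set) module"
    by (rule complex_algebra_Uq)
  show ?thesis
    unfolding s_ser_def by (intro U.finsum_closed) (simp add: image_subset_iff)
qed

lemma Ytw_subset: "Ytw q \<subseteq> carrier (Uq q)"
proof
  interpret U: complex_algebra "Uq q :: (complex, ('a qgen list \<Rightarrow>\<^sub>0 complex) set) module"
    by (rule complex_algebra_Uq)
  fix x :: "('a qgen list \<Rightarrow>\<^sub>0 complex) set" assume "x \<in> Ytw q"
  then show "x \<in> carrier (Uq q)"
    unfolding Ytw_def by induction auto
qed

theorem proposition3p6:
  fixes q :: complex
    and \<Delta> :: "('n::{finite,linorder} qgen list \<Rightarrow>\<^sub>0 complex) set
      \<Rightarrow> (('n qgen list \<Rightarrow>\<^sub>0 complex) set \<times> ('n qgen list \<Rightarrow>\<^sub>0 complex) set \<Rightarrow>\<^sub>0 complex) set"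
  assumes "q \<noteq> 0"
    and "\<forall>n::nat. n > 0 \<longrightarrow> q ^ n \<noteq> 1"
    and "is_coproduct q \<Delta>"
  shows "\<Delta> ` Ytw q \<subseteq> tensor_subspace (Uq q) (Uq q) (carrier (Uq q)) (Ytw q)
    \<and> (\<forall>i j r. \<Delta> (s_ser q i j r) =
          (\<Oplus>\<^bsub>tensor_algebra (Uq q) (Uq q)\<^esub>k\<in>UNIV. \<Oplus>\<^bsub>tensor_algebra (Uq q) (Uq q)\<^esub>l\<in>UNIV.
             ser_tensor (Uq q) (Uq q) (ser_mult (Uq q) (t_ser q i k) (tbar_ser q j l)) (s_ser q k l) r))"
proof -
  let ?U = "Uq q :: (complex, ('n qgen list \<Rightarrow>\<^sub>0 complex) set) module"
  interpret U: complex_algebra ?U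
    by (rule complex_algebra_Uq)
  \<comment> \<open>From here on \<open>T\<close> is the tensor square of
    \<open>Uq q\<close>.\<close>
  interpret algebra_pair ?U ?U ..
  have hom: "\<Delta> \<in> ring_hom ?U T" and \<Delta>_smult: "\<And>c x. x \<in> carrier ?U \<Longrightarrow> \<Delta> (c \<odot>\<^bsub>?U\<^esub> x) = c \<odot>\<^bsub>T\<^esub> \<Delta> x"
    and \<Delta>_t: "\<And>i j r. \<Delta> (t_ser q i j r) = (\<Oplus>\<^bsub>T\<^esub>k\<in>UNIV. ser_tensor ?U ?U (t_ser q i k) (t_ser q k j) r)"
    and \<Delta>_tbar: "\<And>i j r. \<Delta> (tbar_ser q i j r) =
      (\<Oplus>\<^bsub>T\<^esub>k\<in>UNIV. ser_tensor ?U ?U (tbar_ser q i k) (tbar_ser q k j) r)"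
    using assms(3) unfolding is_coproduct_def algebra_hom_def by auto
  interpret \<Delta>: ring_hom_ring ?U T \<Delta>
    by (rule ring_hom_ringI2[OF U.ring_axioms T.ring_axioms hom])
  \<comment> \<open>A coefficient of a Cauchy product is a finite sum of products, so a ring
    homomorphism may be applied coefficient by coefficient.\<close>
  have \<Delta>_ser_mult: "\<Delta> (ser_mult ?U f g r) = ser_mult T (\<lambda>r. \<Delta> (f r)) (\<lambda>r. \<Delta> (g r)) r"
    if "\<And>r. f r \<in> carrier ?U" "\<And>r. g r \<in> carrier ?U" for f g r
    using that by (simp add: ser_mult_def Pi_iff o_def)
  \<comment> \<open>The closure rules for series ask for
    \<open>range f \<subseteq> carrier A\<close>; this reduces that to membership of each
    coefficient.\<close>
  note [simp] = image_subset_iff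
  have \<Delta>_s: "\<Delta> (s_ser q i j r) = (\<Oplus>\<^bsub>T\<^esub>k\<in>UNIV. \<Oplus>\<^bsub>T\<^esub>l\<in>UNIV.
      ser_tensor ?U ?U (ser_mult ?U (t_ser q i k) (tbar_ser q j l)) (s_ser q k l) r)" for i j r
  proof -
    \<comment> \<open>The indices \<open>k\<close> and \<open>l\<close> come from the coproducts of
      t and tbar, and \<open>a\<close> from the definition of \<open>s_ser\<close>. Only the second
      tensor factor involves \<open>a\<close>.\<close>
    let ?F = "\<lambda>k l a. ser_tensor ?U ?U (ser_mult ?U (t_ser q i k) (tbar_ser q j l))
      (ser_mult ?U (t_ser q k a) (tbar_ser q l a)) r"
    have "\<Delta> (s_ser q i j r) = (\<Oplus>\<^bsub>T\<^esub>a\<in>UNIV. \<Delta> (ser_mult ?U (t_ser q i a) (tbar_ser q j a) r))"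
      by (simp add: s_ser_def o_def)
    also have "\<dots> = (\<Oplus>\<^bsub>T\<^esub>a\<in>UNIV. \<Oplus>\<^bsub>T\<^esub>k\<in>UNIV. \<Oplus>\<^bsub>T\<^esub>l\<in>UNIV. ?F k l a)"
    proof (intro T.finsum_cong' refl)
      fix a
      have "\<Delta> (ser_mult ?U (t_ser q i a) (tbar_ser q j a) r) =
        ser_mult T (\<lambda>r. \<Oplus>\<^bsub>T\<^esub>k\<in>UNIV. ser_tensor ?U ?U (t_ser q i k) (t_ser q k a) r)
          (\<lambda>r. \<Oplus>\<^bsub>T\<^esub>l\<in>UNIV. ser_tensor ?U ?U (tbar_ser q j l) (tbar_ser q l a) r) r"
        by (simp add: \<Delta>_ser_mult \<Delta>_t \<Delta>_tbar)
      also have "\<dots> = (\<Oplus>\<^bsub>T\<^esub>k\<in>UNIV. ser_mult T (ser_tensor ?U ?U (t_ser q i k) (t_ser q k a))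
          (\<lambda>r. \<Oplus>\<^bsub>T\<^esub>l\<in>UNIV. ser_tensor ?U ?U (tbar_ser q j l) (tbar_ser q l a) r) r)"
        by (rule T.ser_mult_finsum_left) (auto intro!: T.finsum_closed)
      also have "\<dots> = (\<Oplus>\<^bsub>T\<^esub>k\<in>UNIV. \<Oplus>\<^bsub>T\<^esub>l\<in>UNIV. ser_mult T
          (ser_tensor ?U ?U (t_ser q i k) (t_ser q k a))
          (ser_tensor ?U ?U (tbar_ser q j l) (tbar_ser q l a)) r)"
        by (intro T.finsum_cong' refl T.ser_mult_finsum_right) (auto intro!: T.finsum_closed)
      also have "\<dots> = (\<Oplus>\<^bsub>T\<^esub>k\<in>UNIV. \<Oplus>\<^bsub>T\<^esub>l\<in>UNIV. ?F k l a)"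
        by (simp add: ser_mult_ser_tensor)
      finally show "\<Delta> (ser_mult ?U (t_ser q i a) (tbar_ser q j a) r) =
        (\<Oplus>\<^bsub>T\<^esub>k\<in>UNIV. \<Oplus>\<^bsub>T\<^esub>l\<in>UNIV. ?F k l a)" .
    qed (auto intro!: T.finsum_closed)
    \<comment> \<open>The sum over \<open>a\<close> is moved innermost in two exchanges, first past
      \<open>k\<close> and then past \<open>l\<close>.\<close>
    also have "\<dots> = (\<Oplus>\<^bsub>T\<^esub>k\<in>UNIV. \<Oplus>\<^bsub>T\<^esub>a\<in>UNIV. \<Oplus>\<^bsub>T\<^esub>l\<in>UNIV. ?F k l a)"
      by (rule T.finsum_swap) (auto intro!: T.finsum_closed)
    also have "\<dots> = (\<Oplus>\<^bsub>T\<^esub>k\<in>UNIV. \<Oplus>\<^bsub>T\<^esub>l\<in>UNIV. \<Oplus>\<^bsub>T\<^esub>a\<in>UNIV. ?F k l a)"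
      by (intro T.finsum_cong' refl T.finsum_swap) (auto intro!: T.finsum_closed)
    also have "\<dots> = (\<Oplus>\<^bsub>T\<^esub>k\<in>UNIV. \<Oplus>\<^bsub>T\<^esub>l\<in>UNIV.
      ser_tensor ?U ?U (ser_mult ?U (t_ser q i k) (tbar_ser q j l)) (s_ser q k l) r)"
      \<comment> \<open>Here \<open>s_ser q k l\<close> occurs as a whole series without its
        coefficient index, hence \<open>abs_def\<close>.\<close>
      unfolding s_ser_def[abs_def] by (subst ser_tensor_finsum_right) simp_all
    finally show ?thesis .
  qed
  let ?V = "tensor_subspace ?U ?U (carrier ?U) (Ytw q)"
  have tensor_mem: "tensor ?U ?U x y \<in> ?V" if "x \<in> carrier ?U" "y \<in> Ytw q" for x y
    using that unfolding tensor_subspace_def by (auto intro: lin_span.incl)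
  have s_mem: "s_ser q i j r \<in> Ytw q" for i j r
    unfolding Ytw_def by (auto intro: gen_subalgebra.incl)
  have "\<Delta> x \<in> ?V" if "x \<in> Ytw q" for x
    using that[unfolded Ytw_def]
  proof induction
    case one
    \<comment> \<open>The unit of the tensor square is the pure tensor of the two units, and the
      second of these lies in \<open>Ytw q\<close>.\<close>
    have "\<one>\<^bsub>?U\<^esub> \<in> Ytw q"
      unfolding Ytw_def by (rule gen_subalgebra.one)
    then show ?case
      using tensor_mem[of "\<one>\<^bsub>?U\<^esub>" "\<one>\<^bsub>?U\<^esub>"] by (simp add: tensor_one)
  next
    case (incl x)
    then obtain i j r where "x = s_ser q i j r"
      by auto
    \<comment> \<open>By the formula just proved, each coefficient is a finite sum of pure tensors
      whose second entry is a coefficient of some \<open>s_ser q k l\<close>.\<close>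
    then show ?case
      by (simp only: \<Delta>_s ser_tensor_def)
        (intro finsum_in_tensor_subspace tensor_mem s_mem Ytw_subset order_refl; simp)
  next
    case (add x y)
    then have "\<Delta> (x \<oplus>\<^bsub>?U\<^esub> y) = \<Delta> x \<oplus>\<^bsub>T\<^esub> \<Delta> y"
      using Ytw_subset[of q] by (intro \<Delta>.hom_add) (auto simp: Ytw_def)
    then show ?case
      using add by (simp add: tensor_subspace_def lin_span.add)
  next
    case (mult x y)
    then have "\<Delta> (x \<otimes>\<^bsub>?U\<^esub> y) = \<Delta> x \<otimes>\<^bsub>T\<^esub> \<Delta> y"
      using Ytw_subset[of q] by (intro \<Delta>.hom_mult) (auto simp: Ytw_def)
    \<comment> \<open>Multiplicative closure of the span applies because \<open>carrier ?U\<close>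
      and \<open>Ytw q\<close> are each closed under products.\<close>
    moreover have "\<Delta> x \<otimes>\<^bsub>T\<^esub> \<Delta> y \<in> ?V"
      using mult.IH Ytw_subset
      by (intro tensor_subspace_mult_closed) (auto simp: Ytw_def intro: gen_subalgebra.mult)
    ultimately show ?case
      by simp
  next
    case (smult x c)
    then have "\<Delta> (c \<odot>\<^bsub>?U\<^esub> x) = c \<odot>\<^bsub>T\<^esub> \<Delta> x"
      using Ytw_subset[of q] by (intro \<Delta>_smult) (auto simp: Ytw_def)
    then show ?case
      using smult by (simp add: tensor_subspace_def lin_span.smult)
  qed
  with \<Delta>_s show ?thesis
    by blast
qed

end
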